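(* Let $d\ge2$ be an integer and $p>0$. For integers $N\ge 1$ and complex sequences $a=(a_n)_{1\le n\le N}$ let $S_{a,d}(x,N)=\sum_{n=1}^Na_ne(x_1n+\dots+x_dn^d)$, $x\in\mathbb{T}^d$. Let $\rho_d=\frac{3d^2-4}{4}$ for $d$ even and $\rho_d=\frac{3d^2-3}{4}$ for $d$ odd, and put $\lambda_d(p)=0$ if $p\le\rho_d$, $\lambda_d(p)=\frac{p-\rho_d}{2}$ if $p>\rho_d$. Consider the following two statements. $(\mathrm{B}_p)$: for every positive finite measure $\sigma$ on $\mathbb{T}^d$ satisfying $|\widehat\sigma(\xi)|\lesssim(1+|\xi|)^{-\frac{d-1}{2}}$ for all $\xi\in\mathbb{Z}^d$, every $\epsilon>0$, every $N\ge 1$ and every sequence $a$, $$\int_{\mathbb{T}^d}|S_{a,d}(x,N)|^p\,d\sigma(x)\lesssim_\epsilon N^{\lambda_d(p)+\epsilon}\|a\|_{\ell^2}^p.$$ $(\mathrm{C}_p)$: for every integer $j\ge0$, every $\epsilon>0$, every $N\ge1$ and every sequence $a$, $$2^{j\frac{d+1}{2}}\int_{[0,2^{-j}]^d}|S_{a,d}(x,N)|^p\,dx\lesssim_\epsilon N^{\lambda_d(p)+\epsilon}\|a\|_{\ell^2}^p.$$ If $(\mathrm{B}_p)$ holds for some $p>0$, then $(\mathrm{C}_p)$ holds for the same $p$. If $(\mathrm{C}_p)$ holds for some positive even integer $p$, then $(\mathrm{B}_p)$ holds for the same $p$.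
   Context: $e(t)=e^{2\pi it}$; $\mathbb{T}^d=\mathbb{R}^d/\mathbb{Z}^d$; $\widehat\sigma(\xi)=\int_{\mathbb{T}^d}e(-\xi\cdot x)\,d\sigma(x)$; $\|a\|_{\ell^2}=(\sum_{n=1}^N|a_n|^2)^{1/2}$. In $(\mathrm{B}_p)$ the implicit constant in the conclusion depends only on $\epsilon,d,p$ and on the implicit constant in the Fourier decay hypothesis on $\sigma$; in $(\mathrm{C}_p)$ it depends only on $\epsilon,d,p$ (not on $j,N,a$). *)

theory Defs
  imports "HOL-Analysis.Analysis"
begin

text \<open>
  Points of $\mathbb R^d$ are functions on the index set \<open>{1..d}\<close>, extensional outside it,
  so that \<open>d\<close> remains a numerical parameter; values of frequency and coefficient vectors outside
  their index sets are never used.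
\<close>

definition e :: "real \<Rightarrow> complex" where
  "e t = cis (2 * pi * t)"

text \<open>
  The Borel space of $\mathbb T^d = \mathbb R^d/\mathbb Z^d$, identified with the fundamental
  domain $[0,1)^d$. The quotient map restricts to a Borel isomorphism from $[0,1)^d$ onto
  $\mathbb T^d$, so Borel measures on the two spaces correspond, masses on the faces
  included. Only the underlying set and the sigma-algebra matter here, not the (null) measure that
  \<open>PiM\<close> attaches to them.
\<close>

definition torus :: "nat \<Rightarrow> (nat \<Rightarrow> real) measure" where
  "torus d = (\<Pi>\<^sub>M i\<in>{1..d}. restrict_space borel {0..<1})"

definition fourier_coeff :: "nat \<Rightarrow> (nat \<Rightarrow> real) measure \<Rightarrow> (nat \<Rightarrow> int) \<Rightarrow> complex" where
  "fourier_coeff d \<sigma> \<xi> = (\<integral>x. e (- (\<Sum>i=1..d. of_int (\<xi> i) * x i)) \<partial>\<sigma>)"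

definition weyl_sum :: "nat \<Rightarrow> (nat \<Rightarrow> complex) \<Rightarrow> (nat \<Rightarrow> real) \<Rightarrow> nat \<Rightarrow> complex" where
  "weyl_sum d a x N = (\<Sum>n=1..N. a n * e (\<Sum>i=1..d. x i * real n ^ i))"

definition l2_norm :: "nat \<Rightarrow> (nat \<Rightarrow> complex) \<Rightarrow> real" where
  "l2_norm N a = L2_set (\<lambda>n. cmod (a n)) {1..N}"

definition \<rho> :: "nat \<Rightarrow> real" where
  "\<rho> d = (if even d then (3 * (real d)\<^sup>2 - 4) / 4 else (3 * (real d)\<^sup>2 - 3) / 4)"

definition lam :: "nat \<Rightarrow> real \<Rightarrow> real" where
  "lam d p = (if p \<le> \<rho> d then 0 else (p - \<rho> d) / 2)"

definition fourier_decay :: "nat \<Rightarrow> real \<Rightarrow> (nat \<Rightarrow> real) measure \<Rightarrow> bool" where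
  "fourier_decay d K \<sigma> \<longleftrightarrow>
     (\<forall>\<xi> :: nat \<Rightarrow> int. cmod (fourier_coeff d \<sigma> \<xi>)
        \<le> K * (1 + L2_set (\<lambda>i. real_of_int (\<xi> i)) {1..d}) powr (- (real d - 1) / 2))"

text \<open>
  The constant \<open>C\<close> may depend on \<open>\<epsilon>\<close>, \<open>d\<close>, \<open>p\<close> and on the decay constant \<open>K\<close>, but not on
  \<open>\<sigma>\<close>, \<open>N\<close>, \<open>a\<close>.
\<close>

definition B_stmt :: "nat \<Rightarrow> real \<Rightarrow> bool" where
  "B_stmt d p \<longleftrightarrow>
     (\<forall>\<epsilon>>0. \<forall>K>0. \<exists>C>0. \<forall>\<sigma> :: (nat \<Rightarrow> real) measure.
        sets \<sigma> = sets (torus d) \<longrightarrow> finite_measure \<sigma> \<longrightarrow> fourier_decay d K \<sigma> \<longrightarrow>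
        (\<forall>N\<ge>1. \<forall>a :: nat \<Rightarrow> complex.
           (\<integral>x. cmod (weyl_sum d a x N) powr p \<partial>\<sigma>)
             \<le> C * real N powr (lam d p + \<epsilon>) * l2_norm N a powr p))"

definition C_stmt :: "nat \<Rightarrow> real \<Rightarrow> bool" where
  "C_stmt d p \<longleftrightarrow>
     (\<forall>\<epsilon>>0. \<exists>C>0. \<forall>j :: nat. \<forall>N\<ge>1. \<forall>a :: nat \<Rightarrow> complex.
        2 powr (real j * (real d + 1) / 2) *
          (\<integral>x \<in> (\<Pi>\<^sub>E i\<in>{1..d}. {0..1 / 2 ^ j}).
             cmod (weyl_sum d a x N) powr p \<partial>(\<Pi>\<^sub>M i\<in>{1..d}. lborel))
          \<le> C * real N powr (lam d p + \<epsilon>) * l2_norm N a powr p)"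

end

theory Submission
  imports Defs
begin

text \<open>
  From measures to cubes: test \<open>B_stmt\<close> on the measure $2^{j(d+1)/2}\prod_i F(x_i)\,dx$, where
  $F = |\frac1n\sum_{k<n} e(kt)|^2$ and $n \approx 2^j/8$. The density is comparable to
  $2^{j(d+1)/2}$ on $[0,2^{-j}]^d$, and its Fourier coefficients are at most
  $2^{j(d+1)/2}n^{-d}$ and vanish unless all $|\xi_i| < n$, which gives the decay uniformly in $j$.

  From cubes to measures, for an even exponent $2s$: expand $|S_a|^{2s} = \sum_g A_g e(\xi_g\cdot x)$,
  so that the moment is at most $K\sum_g |A_g|(1+|\xi_g|)^{-(d-1)/2}$. Decompose dyadically in
  $|\xi_g|$; there are only $O(\log N)$ scales. The coefficients of $|S_{|a|}|^{2s}$ are $|A_g|$,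
  hence the mass $\sum_{|\xi_g|\lesssim 2^j}|A_g|$ is controlled by integrating $|S_{|a|}|^{2s}$
  against a positive definite function concentrated at scale $2^{-j}$, and translations of
  $x$ are modulations of the sequence.
\<close>

section \<open>Characters\<close>

definition character :: "nat \<Rightarrow> (nat \<Rightarrow> int) \<Rightarrow> (nat \<Rightarrow> real) \<Rightarrow> complex" where
  "character d m x = e (\<Sum>i=1..d. of_int (m i) * x i)"

lemma e_add: "e (s + t) = e s * e t"
  by (simp add: e_def cis_mult distrib_left)

lemma e_minus: "e (- t) = cnj (e t)"
  by (simp add: e_def cis_cnj)

lemma e_diff: "e (s - t) = e s * cnj (e t)"
  using e_add[of s "- t"] by (simp add: e_minus)

lemma e_0 [simp]: "e 0 = 1"
  by (simp add: e_def)

lemma norm_e [simp]: "cmod (e t) = 1"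
  by (simp add: e_def)

lemma e_of_int [simp]: "e (of_int k) = 1"
  by (simp add: e_def cis_multiple_2pi)

text \<open>The angle is at most pi/4, which lies below pi/3. This threshold 1/8 is the source of
  the factors 8 in the frequency cutoffs below and of the kernel length
  \<open>2 ^ (j - 3)\<close>.\<close>

lemma Re_e_ge:
  assumes "8 * \<bar>t\<bar> \<le> 1"
  shows "1 / 2 \<le> Re (e t)"
proof -
  have "\<bar>2 * pi * t\<bar> \<le> 2 * pi * (1 / 8)"
    using assms by (simp add: abs_mult)
  then have "cos (pi / 3) \<le> cos \<bar>2 * pi * t\<bar>"
    by (intro cos_monotone_0_pi_le) auto
  then show ?thesis by (simp add: e_def cos_60)
qed

lemma e_sum: "e (\<Sum>i\<in>A. f i) = (\<Prod>i\<in>A. e (f i))"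
  by (induction A rule: infinite_finite_induct) (simp_all add: e_add)

lemma continuous_on_e [continuous_intros]:
  "continuous_on A f \<Longrightarrow> continuous_on A (\<lambda>x. e (f x))"
  unfolding e_def by (intro continuous_intros)

lemma e_measurable [measurable]: "e \<in> borel_measurable borel"
  by (intro borel_measurable_continuous_onI continuous_intros)

lemma cnj_measurable [measurable]: "cnj \<in> borel_measurable borel"
  by (intro borel_measurable_continuous_onI continuous_intros)

lemma character_prod: "character d m x = (\<Prod>i=1..d. e (of_int (m i) * x i))"
  by (simp add: character_def e_sum)

lemma norm_character [simp]: "cmod (character d m x) = 1"
  by (simp add: character_def)

lemma character_diff:
  "character d (\<lambda>i. m i - l i) x = character d m x * cnj (character d l x)"
  by (simp add: character_def e_diff[symmetric] left_diff_distrib sum_subtractf)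

lemma character_sum:
  "character d (\<lambda>i. \<Sum>k\<in>A. m k i) x = (\<Prod>k\<in>A. character d (m k) x)"
  unfolding character_def e_sum[symmetric]
  by (subst sum.swap) (simp add: sum_distrib_right)

lemma character_cong:
  "(\<And>i. i \<in> {1..d} \<Longrightarrow> x i = y i) \<Longrightarrow> character d m x = character d m y"
  unfolding character_def by (metis (mono_tags, lifting) sum.cong)

text \<open>Integer frequencies make characters 1-periodic in each variable. This is what allows
  integrals over the closed unit cube to be compared with integrals over the fundamental
  domain.\<close>

lemma character_frac: "character d m (\<lambda>i. frac (x i)) = character d m x"
proof -
  have "e (of_int k * frac t) = e (of_int k * t)" for k t
  proof -
    have "of_int k * frac t = of_int k * t - of_int (k * \<lfloor>t\<rfloor>)"
      by (simp add: frac_def algebra_simps)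
    then show ?thesis by (simp only: e_diff e_of_int) simp
  qed
  then show ?thesis by (simp add: character_prod)
qed

lemma weyl_sum_character:
  "weyl_sum d a x N = (\<Sum>n=1..N. a n * character d (\<lambda>i. int n ^ i) x)"
  by (simp add: weyl_sum_def character_def mult.commute)

lemma norm_weyl_sum_le: "cmod (weyl_sum d a x N) \<le> (\<Sum>n=1..N. cmod (a n))"
  unfolding weyl_sum_character by (rule order_trans[OF norm_sum]) (simp add: norm_mult)

lemma fourier_coeff_character:
  "fourier_coeff d \<sigma> \<xi> = (\<integral>x. character d (\<lambda>i. - \<xi> i) x \<partial>\<sigma>)"
  by (simp add: fourier_coeff_def character_def sum_negf)

lemma character_measurable:
  assumes "\<And>i. i \<in> {1..d} \<Longrightarrow> (\<lambda>x. x i) \<in> borel_measurable M"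
  shows "character d m \<in> borel_measurable M"
proof -
  have [measurable]: "(\<lambda>x. \<Sum>i=1..d. of_int (m i) * x i) \<in> borel_measurable M"
    by (intro borel_measurable_sum borel_measurable_times) (simp_all add: assms)
  show ?thesis unfolding character_def[abs_def] by measurable
qed

abbreviation Leb :: "nat \<Rightarrow> (nat \<Rightarrow> real) measure" where
  "Leb d \<equiv> (\<Pi>\<^sub>M i\<in>{1..d}. lborel)"

abbreviation cube :: "nat \<Rightarrow> real \<Rightarrow> (nat \<Rightarrow> real) set" where
  "cube d h \<equiv> (\<Pi>\<^sub>E i\<in>{1..d}. {0..h})"

lemma character_measurable_Leb [measurable]: "character d m \<in> borel_measurable (Leb d)"
  by (rule character_measurable) measurable

lemma weyl_sum_measurable_Leb [measurable]:
  "(\<lambda>x. weyl_sum d a x N) \<in> borel_measurable (Leb d)"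
  unfolding weyl_sum_character by measurable

lemma sets_torus_coordinate:
  assumes "sets \<sigma> = sets (torus d)" "i \<in> {1..d}"
  shows "(\<lambda>x. x i) \<in> borel_measurable \<sigma>"
proof -
  have "(\<lambda>x. x i) \<in> measurable (torus d) (restrict_space borel {0..<1::real})"
    unfolding torus_def using assms(2) by (rule measurable_component_singleton)
  then have "(\<lambda>x. x i) \<in> borel_measurable (torus d)"
    by (simp add: measurable_restrict_space2_iff)
  then show ?thesis by (simp cong: measurable_cong_sets add: assms(1))
qed

section \<open>Integrals over cubes\<close>

lemma cube_sets [measurable]: "cube d h \<in> sets (Leb d)"
  by (rule sets_PiM_I_finite) auto

lemma emeasure_cube: "0 \<le> h \<Longrightarrow> emeasure (Leb d) (cube d h) = ennreal (h ^ d)"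
proof -
  assume h: "0 \<le> h"
  interpret product_sigma_finite "\<lambda>_::nat. lborel :: real measure" by standard
  show ?thesis using h by (subst emeasure_PiM) (simp_all add: ennreal_power)
qed

lemma measure_cube: "0 \<le> h \<Longrightarrow> measure (Leb d) (cube d h) = h ^ d"
  unfolding measure_def by (subst emeasure_cube) simp_all

lemma set_integrable_cube_bounded:
  fixes f :: "_ \<Rightarrow> 'b::{banach, second_countable_topology}"
  assumes "f \<in> borel_measurable (Leb d)" "\<And>x. x \<in> cube d h \<Longrightarrow> norm (f x) \<le> B" "0 \<le> h"
  shows "set_integrable (Leb d) (cube d h) f"
  unfolding set_integrable_def
  by (rule integrableI_bounded_set_indicator[where B = B])
    (use assms in \<open>auto simp: emeasure_cube[simplified]\<close>)

lemma integral_cube_prod: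
  fixes f :: "nat \<Rightarrow> real \<Rightarrow> 'b::{real_normed_field, banach, second_countable_topology}"
  assumes "\<And>i. i \<in> {1..d} \<Longrightarrow> set_integrable lborel {0..h} (f i)"
  shows "(\<integral>x\<in>cube d h. (\<Prod>i=1..d. f i (x i)) \<partial>Leb d) = (\<Prod>i=1..d. \<integral>t\<in>{0..h}. f i t \<partial>lborel)"
proof -
  interpret product_sigma_finite "\<lambda>_::nat. lborel :: real measure" by standard
  have "(\<integral>x\<in>cube d h. (\<Prod>i=1..d. f i (x i)) \<partial>Leb d)
      = (\<integral>x. (\<Prod>i=1..d. indicator {0..h} (x i) *\<^sub>R f i (x i)) \<partial>Leb d)"
    unfolding set_lebesgue_integral_def
  proof (rule Bochner_Integration.integral_cong[OF refl])
    fix x assume "x \<in> space (Leb d)"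
    \<comment> \<open>Extensionality is what makes the indicator of the cube split into one-variable
      indicators: an extensional point outside the cube has some coordinate in \<open>{1..d}\<close>
      outside \<open>{0..h}\<close>, and the corresponding factor vanishes.\<close>
    then have x: "x \<in> extensional {1..d}" by (simp add: space_PiM PiE_def)
    show "indicator (cube d h) x *\<^sub>R (\<Prod>i=1..d. f i (x i))
        = (\<Prod>i=1..d. indicator {0..h} (x i) *\<^sub>R f i (x i))"
    proof (cases "x \<in> cube d h")
      case True
      then show ?thesis by (auto intro!: prod.cong simp: PiE_def Pi_def)
    next
      case False
      with x obtain i where i: "i \<in> {1..d}" "x i \<notin> {0..h}" by (auto simp: PiE_def Pi_def)
      then have "indicator {0..h} (x i) *\<^sub>R f i (x i) = 0" by simp
      with i have "(\<Prod>i=1..d. indicator {0..h} (x i) *\<^sub>R f i (x i)) = 0"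
        by (intro prod_zero) blast+
      with False show ?thesis by simp
    qed
  qed
  also have "\<dots> = (\<Prod>i=1..d. \<integral>t. indicator {0..h} t *\<^sub>R f i t \<partial>lborel)"
    by (rule product_integral_prod) (use assms in \<open>auto simp: set_integrable_def\<close>)
  finally show ?thesis by (simp add: set_lebesgue_integral_def)
qed

lemma set_integrable_e: "set_integrable lborel {0..h} (\<lambda>t. e (c * t))"
  unfolding set_integrable_def
  by (rule borel_integrable_compact) (auto intro!: continuous_intros)

lemma integral_character_cube:
  "(\<integral>x\<in>cube d h. character d m x \<partial>Leb d)
    = (\<Prod>i=1..d. \<integral>t\<in>{0..h}. e (of_int (m i) * t) \<partial>lborel)"
  unfolding character_prod by (rule integral_cube_prod) (rule set_integrable_e)

lemma integral_e_unit:
  "(\<integral>t\<in>{0..1}. e (of_int k * t) \<partial>lborel) = (if k = 0 then 1 else 0)"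
proof (cases "k = 0")
  case True
  then show ?thesis by (simp add: set_lebesgue_integral_def)
next
  case False
  \<comment> \<open>The integrand is exp(ct) with primitive exp(ct)/c, and it equals 1 at both
    integer end points.\<close>
  define c where "c = 2 * of_real pi * of_int k * \<i>"
  have c: "c \<noteq> 0" using False by (simp add: c_def)
  have ee: "e (of_int k * t) = exp (c * of_real t)" for t
    by (simp add: e_def cis_conv_exp c_def mult_ac)
  have "(\<integral>t\<in>{0..1}. e (of_int k * t) \<partial>lborel) = integral {0..1} (\<lambda>t. e (of_int k * t))"
    by (rule set_borel_integral_eq_integral(2)[OF set_integrable_e])
  also have "\<dots> = e (of_int k * 1) / c - e (of_int k * 0) / c"
    unfolding ee
    by (intro integral_unique fundamental_theorem_of_calculus)
      (auto intro!: derivative_eq_intros has_vector_derivative_real_field simp: c)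
  also have "\<dots> = 0" by simp
  finally show ?thesis using False by simp
qed

text \<open>No cancellation occurs at frequencies up to 1/(8h), because the integrand then has real
  part at least 1/2 throughout.\<close>

lemma norm_integral_e_ge:
  assumes "0 \<le> h" "8 * \<bar>real_of_int k\<bar> * h \<le> 1"
  shows "cmod (\<integral>t\<in>{0..h}. e (of_int k * t) \<partial>lborel) \<ge> h / 2"
proof -
  have "h / 2 = (\<integral>t\<in>{0..h}. 1/2 \<partial>lborel)"
    using assms by (simp add: set_lebesgue_integral_def)
  also have "\<dots> \<le> (\<integral>t\<in>{0..h}. Re (e (of_int k * t)) \<partial>lborel)"
  proof (rule set_integral_mono)
    show "set_integrable lborel {0..h} (\<lambda>t. Re (e (of_int k * t)))"
      using integrable_Re[OF set_integrable_e[unfolded set_integrable_def]]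
      by (simp add: set_integrable_def)
    fix t assume t: "t \<in> {0..h}"
    have "\<bar>real_of_int k * t\<bar> \<le> \<bar>real_of_int k\<bar> * h"
      using t by (auto simp: abs_mult intro!: mult_left_mono)
    with assms have "8 * \<bar>real_of_int k * t\<bar> \<le> 1" by linarith
    then show "1 / 2 \<le> Re (e (of_int k * t))" by (intro Re_e_ge) simp
  qed (rule borel_integrable_atLeastAtMost'[OF continuous_on_const])
  also have "\<dots> = Re (\<integral>t\<in>{0..h}. e (of_int k * t) \<partial>lborel)"
    using integral_Re[OF set_integrable_e[unfolded set_integrable_def]]
    by (simp add: set_lebesgue_integral_def)
  also have "\<dots> \<le> cmod (\<integral>t\<in>{0..h}. e (of_int k * t) \<partial>lborel)"
    by (rule complex_Re_le_cmod)
  finally show ?thesis .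
qed

section \<open>Even moments as exponential sums\<close>

text \<open>An element picks one pair (n, m) from each of the s factors S * cnj S of the 2s-th power
  of the modulus.\<close>

definition tuples :: "nat \<Rightarrow> nat \<Rightarrow> (nat \<Rightarrow> nat \<times> nat) set" where
  "tuples s N = {..<s} \<rightarrow>\<^sub>E {1..N} \<times> {1..N}"

definition coef :: "(nat \<Rightarrow> complex) \<Rightarrow> nat \<Rightarrow> (nat \<Rightarrow> nat \<times> nat) \<Rightarrow> complex" where
  "coef a s g = (\<Prod>k<s. a (fst (g k)) * cnj (a (snd (g k))))"

text \<open>The components are the differences of power sums that occur in the Vinogradov
  system.\<close>

definition freq :: "nat \<Rightarrow> (nat \<Rightarrow> nat \<times> nat) \<Rightarrow> nat \<Rightarrow> int" where
  "freq s g i = (\<Sum>k<s. int (fst (g k)) ^ i - int (snd (g k)) ^ i)"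

lemma finite_tuples [simp]: "finite (tuples s N)"
  by (simp add: tuples_def finite_PiE)

text \<open>Evenness of the exponent enters here: the power is (S * cnj S)^s, a product of finite
  sums, hence a finite trigonometric polynomial.\<close>

lemma weyl_sum_even_power:
  "of_real (cmod (weyl_sum d a x N) ^ (2 * s))
    = (\<Sum>g\<in>tuples s N. coef a s g * character d (freq s g) x)"
proof -
  let ?t = "\<lambda>n. a n * character d (\<lambda>i. int n ^ i) x"
  let ?u = "\<lambda>(n, m). a n * cnj (a m) * character d (\<lambda>i. int n ^ i - int m ^ i) x"
  have "weyl_sum d a x N * cnj (weyl_sum d a x N) = (\<Sum>n=1..N. \<Sum>m=1..N. ?t n * cnj (?t m))"
    unfolding weyl_sum_character cnj_sum by (rule sum_product)
  also have "\<dots> = (\<Sum>nm\<in>{1..N} \<times> {1..N}. ?u nm)"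
    by (subst sum.cartesian_product) (auto intro!: sum.cong simp: character_diff mult_ac)
  finally have sq: "weyl_sum d a x N * cnj (weyl_sum d a x N) = (\<Sum>nm\<in>{1..N} \<times> {1..N}. ?u nm)" .
  have "of_real (cmod (weyl_sum d a x N) ^ (2 * s))
      = (weyl_sum d a x N * cnj (weyl_sum d a x N)) ^ s"
    by (simp add: power_mult flip: complex_norm_square)
  also have "\<dots> = (\<Prod>k<s. \<Sum>nm\<in>{1..N} \<times> {1..N}. ?u nm)"
    by (simp add: sq)
  also have "\<dots> = (\<Sum>g\<in>tuples s N. \<Prod>k<s. ?u (g k))"
    unfolding tuples_def by (rule prod_sum_PiE) auto
  also have "\<dots> = (\<Sum>g\<in>tuples s N. coef a s g * character d (freq s g) x)"
    unfolding freq_def[abs_def] character_sum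
    by (simp add: coef_def case_prod_beta prod.distrib)
  finally show ?thesis .
qed

text \<open>Both powers lie between 0 and N^d, so each difference is at most N^d in modulus.
  Polynomial size of the frequencies is what keeps the number of dyadic scales logarithmic in
  N.\<close>

lemma freq_bound:
  assumes "g \<in> tuples s N" "N \<ge> 1" "i \<le> d"
  shows "\<bar>real_of_int (freq s g i)\<bar> \<le> real s * real N ^ d"
proof -
  have "\<bar>real_of_int (freq s g i)\<bar> \<le> (\<Sum>k<s. \<bar>real (fst (g k)) ^ i - real (snd (g k)) ^ i\<bar>)"
    by (simp add: freq_def)
  also have "\<dots> \<le> (\<Sum>k<s. real N ^ d)"
  proof (rule sum_mono)
    have le: "real n ^ i \<le> real N ^ d" if "n \<le> N" for n
      using that assms power_mono[of "real n" "real N" i] power_increasing[of i d "real N"] by simp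
    fix k assume "k \<in> {..<s}"
    then have "g k \<in> {1..N} \<times> {1..N}" using assms(1) by (auto simp: tuples_def PiE_def Pi_def)
    then have "fst (g k) \<le> N" "snd (g k) \<le> N" by auto
    from this[THEN le] show "\<bar>real (fst (g k)) ^ i - real (snd (g k)) ^ i\<bar> \<le> real N ^ d"
      using zero_le_power[of "real (fst (g k))" i] zero_le_power[of "real (snd (g k))" i] by linarith
  qed
  finally show ?thesis by simp
qed

text \<open>Keeps the right-hand side of the cube estimate unchanged when \<open>a\<close> is
  replaced by a modulation of its moduli.\<close>

lemma l2_norm_cong:
  "(\<And>n. n \<in> {1..N} \<Longrightarrow> cmod (a n) = cmod (b n)) \<Longrightarrow> l2_norm N a = l2_norm N b"
  unfolding l2_norm_def by (rule L2_set_cong) auto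

lemma set_integrable_sum:
  fixes f :: "_ \<Rightarrow> _ \<Rightarrow> _ :: {banach, second_countable_topology}"
  assumes "\<And>i. i \<in> I \<Longrightarrow> set_integrable M A (f i)"
  shows "set_integrable M A (\<lambda>x. \<Sum>i\<in>I. f i x)"
  using assms unfolding set_integrable_def scaleR_sum_right
  by (rule Bochner_Integration.integrable_sum)

lemma set_integral_sum:
  fixes f :: "_ \<Rightarrow> _ \<Rightarrow> _ :: {banach, second_countable_topology}"
  assumes "\<And>i. i \<in> I \<Longrightarrow> set_integrable M A (f i)"
  shows "(\<integral>x\<in>A. (\<Sum>i\<in>I. f i x) \<partial>M) = (\<Sum>i\<in>I. \<integral>x\<in>A. f i x \<partial>M)"
  using assms unfolding set_lebesgue_integral_def set_integrable_def scaleR_sum_right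
  by (rule Bochner_Integration.integral_sum)

text \<open>
  With $Q = [0,h]^d$ the average $\int_Q\int_Q |S_{|a|}(x-y)|^{2s}\,dx\,dy$ has the nonnegative
  expansion $\sum_g |A_g|\,|\widehat{1_Q}(\xi_g)|^2$, while for fixed \<open>y\<close> the inner integral
  is the one over \<open>Q\<close> for a modulation of \<open>|a|\<close>.
\<close>

lemma low_frequency_mass:
  fixes a :: "nat \<Rightarrow> complex"
  assumes "0 < h"
    and bound: "\<And>b. (\<And>n. cmod (b n) = cmod (a n)) \<Longrightarrow>
      (\<integral>x\<in>cube d h. cmod (weyl_sum d b x N) ^ (2 * s) \<partial>Leb d) \<le> B"
  shows "(\<Sum>g | g \<in> tuples s N \<and> (\<forall>i\<in>{1..d}. 8 * \<bar>real_of_int (freq s g i)\<bar> * h \<le> 1).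
           cmod (coef a s g)) * h ^ d \<le> 4 ^ d * B"
proof -
  define Q where "Q g = (\<integral>x\<in>cube d h. character d (freq s g) x \<partial>Leb d)" for g
  \<comment> \<open>The Weyl sum of \<open>b y\<close> at x is that of the moduli of
    \<open>a\<close> at x - y. Since \<open>b y\<close> has the same moduli as \<open>a\<close>, the
    hypothesis \<open>bound\<close> applies to it for every y.\<close>
  define b where "b y n = of_real (cmod (a n)) * cnj (character d (\<lambda>i. int n ^ i) y)" for y n
  define I where "I y = (\<integral>x\<in>cube d h. cmod (weyl_sum d (b y) x N) ^ (2 * s) \<partial>Leb d)" for y
  define G where "G = {g \<in> tuples s N. \<forall>i\<in>{1..d}. 8 * \<bar>real_of_int (freq s g i)\<bar> * h \<le> 1}"
  have intc: "set_integrable (Leb d) (cube d h) (\<lambda>x. z * character d m x)" for z m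
    by (rule set_integrable_cube_bounded[where B = "cmod z"]; (measurable)?)
      (use assms(1) in \<open>auto simp: norm_mult\<close>)
  have intcc: "set_integrable (Leb d) (cube d h) (\<lambda>x. z * cnj (character d m x))" for z m
    by (rule set_integrable_cube_bounded[where B = "cmod z"]; (measurable)?)
      (use assms(1) in \<open>auto simp: norm_mult\<close>)
  have norm_b: "cmod (b y n) = cmod (a n)" for y n
    by (simp add: b_def norm_mult)
  have coef_b: "coef (b y) s g = of_real (cmod (coef a s g)) * cnj (character d (freq s g) y)" for y g
    unfolding freq_def[abs_def] character_sum character_diff
    by (simp add: coef_def b_def prod.distrib norm_mult mult_ac flip: prod_norm)
  have I_eq: "of_real (I y)
      = (\<Sum>g\<in>tuples s N. of_real (cmod (coef a s g)) * Q g * cnj (character d (freq s g) y))" for y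
  proof -
    have "of_real (I y)
        = (\<integral>x\<in>cube d h. of_real (cmod (weyl_sum d (b y) x N) ^ (2 * s)) \<partial>Leb d :: complex)"
      unfolding I_def by (rule set_integral_complex_of_real[symmetric])
    also have "\<dots> = (\<Sum>g\<in>tuples s N. \<integral>x\<in>cube d h. coef (b y) s g * character d (freq s g) x \<partial>Leb d)"
      unfolding weyl_sum_even_power by (rule set_integral_sum) (rule intc)
    also have "\<dots> = (\<Sum>g\<in>tuples s N. of_real (cmod (coef a s g)) * Q g * cnj (character d (freq s g) y))"
      by (simp add: Q_def coef_b mult_ac)
    finally show ?thesis .
  qed
  have cnj_Q: "cnj (Q g) = (\<integral>x\<in>cube d h. cnj (character d (freq s g) x) \<partial>Leb d)" for g
    unfolding Q_def set_lebesgue_integral_def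
    by (simp flip: Bochner_Integration.integral_cnj)
  have "of_real (\<integral>y\<in>cube d h. I y \<partial>Leb d) = (\<integral>y\<in>cube d h. of_real (I y) \<partial>Leb d :: complex)"
    by (rule set_integral_complex_of_real[symmetric])
  also have "\<dots> = (\<Sum>g\<in>tuples s N.
      \<integral>y\<in>cube d h. of_real (cmod (coef a s g)) * Q g * cnj (character d (freq s g) y) \<partial>Leb d)"
    unfolding I_eq by (rule set_integral_sum) (rule intcc)
  also have "\<dots> = (\<Sum>g\<in>tuples s N. of_real (cmod (coef a s g)) * (Q g * cnj (Q g)))"
    by (simp add: cnj_Q mult.assoc)
  also have "\<dots> = of_real (\<Sum>g\<in>tuples s N. cmod (coef a s g) * (cmod (Q g))\<^sup>2)"
    by (simp flip: complex_norm_square)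
  finally have double: "(\<integral>y\<in>cube d h. I y \<partial>Leb d)
      = (\<Sum>g\<in>tuples s N. cmod (coef a s g) * (cmod (Q g))\<^sup>2)"
    by (simp only: of_real_eq_iff)
  have I_nonneg: "0 \<le> I y" for y
    unfolding I_def set_lebesgue_integral_def by (intro Bochner_Integration.integral_nonneg) simp
  have I_le: "I y \<le> B" for y
    unfolding I_def by (rule bound) (rule norm_b)
  \<comment> \<open>The finite expansion exhibits \<open>I\<close> as a trigonometric polynomial,
    from which its measurability can be read off without a parametrised-integral argument.\<close>
  have I_Re: "I y = Re (\<Sum>g\<in>tuples s N.
      of_real (cmod (coef a s g)) * Q g * cnj (character d (freq s g) y))" for y
    by (simp flip: I_eq)
  have measurable_I: "I \<in> borel_measurable (Leb d)"
    unfolding I_Re[abs_def] by measurable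
  have "(\<integral>y\<in>cube d h. I y \<partial>Leb d) \<le> (\<integral>y\<in>cube d h. B \<partial>Leb d)"
  proof (rule set_integral_mono)
    show "set_integrable (Leb d) (cube d h) I"
      by (rule set_integrable_cube_bounded[where B = B, OF measurable_I])
        (use I_nonneg I_le assms(1) in auto)
    show "set_integrable (Leb d) (cube d h) (\<lambda>y. B)"
      by (rule set_integrable_cube_bounded[where B = "\<bar>B\<bar>"]) (use assms(1) in auto)
  qed (rule I_le)
  also have "\<dots> = B * h ^ d"
    using assms(1) measure_cube[of h d] by (simp add: set_lebesgue_integral_def)
  finally have le: "(\<Sum>g\<in>tuples s N. cmod (coef a s g) * (cmod (Q g))\<^sup>2) \<le> B * h ^ d"
    by (simp only: double)
  have Q_ge: "(h / 2) ^ d \<le> cmod (Q g)" if "g \<in> G" for g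
  proof -
    have "(h / 2) ^ d = (\<Prod>i=1..d. h / 2)" by simp
    also have "\<dots> \<le> (\<Prod>i=1..d. cmod (\<integral>t\<in>{0..h}. e (of_int (freq s g i) * t) \<partial>lborel))"
      using that assms(1) by (intro prod_mono conjI norm_integral_e_ge) (auto simp: G_def)
    also have "\<dots> = cmod (Q g)"
      unfolding Q_def integral_character_cube by (rule prod_norm)
    finally show ?thesis .
  qed
  have "(\<Sum>g\<in>G. cmod (coef a s g)) * ((h / 2) ^ d)\<^sup>2
      = (\<Sum>g\<in>G. cmod (coef a s g) * ((h / 2) ^ d)\<^sup>2)"
    by (rule sum_distrib_right)
  also have "\<dots> \<le> (\<Sum>g\<in>G. cmod (coef a s g) * (cmod (Q g))\<^sup>2)"
    using assms(1) by (intro sum_mono mult_left_mono power_mono Q_ge) auto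
  also have "\<dots> \<le> (\<Sum>g\<in>tuples s N. cmod (coef a s g) * (cmod (Q g))\<^sup>2)"
    by (rule sum_mono2) (auto simp: G_def)
  also note le
  finally have *: "(\<Sum>g\<in>G. cmod (coef a s g)) * ((h / 2) ^ d)\<^sup>2 \<le> B * h ^ d" .
  \<comment> \<open>Squaring the lower bound yields the constant 4^d, and one of the two factors h^d
    cancels against the volume of the cube in y.\<close>
  have "((h / 2) ^ d)\<^sup>2 = h ^ d * h ^ d / 4 ^ d"
    by (simp add: power_divide power2_eq_square flip: power_mult_distrib)
  from *[unfolded this] have "(\<Sum>g\<in>G. cmod (coef a s g)) * h ^ d * h ^ d \<le> (4 ^ d * B) * h ^ d"
    by (simp add: field_simps)
  then have "(\<Sum>g\<in>G. cmod (coef a s g)) * h ^ d \<le> 4 ^ d * B"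
    by (rule mult_right_le_imp_le) (use assms(1) in simp)
  then show ?thesis by (simp add: G_def)
qed

section \<open>Moments against a measure with Fourier decay\<close>

text \<open>The trigonometric polynomial is integrated term by term, each character giving a Fourier
  coefficient of the measure, and the triangle inequality then brings in the decay.\<close>

lemma moment_le_coef_sum:
  assumes "sets \<sigma> = sets (torus d)" "finite_measure \<sigma>" "fourier_decay d K \<sigma>"
  shows "(\<integral>x. cmod (weyl_sum d a x N) ^ (2 * s) \<partial>\<sigma>)
    \<le> (\<Sum>g\<in>tuples s N. cmod (coef a s g) *
        (K * (1 + L2_set (\<lambda>i. real_of_int (freq s g i)) {1..d}) powr (- (real d - 1) / 2)))"
proof -
  interpret finite_measure \<sigma> by fact
  have [measurable]: "character d m \<in> borel_measurable \<sigma>" for m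
    by (rule character_measurable) (rule sets_torus_coordinate[OF assms(1)])
  have int: "integrable \<sigma> (\<lambda>x. z * character d m x)" for z m
    by (rule integrable_const_bound[where B = "cmod z"]) (auto simp: norm_mult)
  have "complex_of_real (\<integral>x. cmod (weyl_sum d a x N) ^ (2 * s) \<partial>\<sigma>)
      = (\<integral>x. (\<Sum>g\<in>tuples s N. coef a s g * character d (freq s g) x) \<partial>\<sigma>)"
    unfolding weyl_sum_even_power[symmetric] by (rule integral_complex_of_real[symmetric])
  also have "\<dots> = (\<Sum>g\<in>tuples s N. coef a s g * fourier_coeff d \<sigma> (\<lambda>i. - freq s g i))"
    by (subst Bochner_Integration.integral_sum) (auto simp: int fourier_coeff_character)
  finally have eq: "complex_of_real (\<integral>x. cmod (weyl_sum d a x N) ^ (2 * s) \<partial>\<sigma>) = \<dots>" .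
  have "(\<integral>x. cmod (weyl_sum d a x N) ^ (2 * s) \<partial>\<sigma>)
      \<le> cmod (complex_of_real (\<integral>x. cmod (weyl_sum d a x N) ^ (2 * s) \<partial>\<sigma>))"
    by simp
  also have "\<dots> \<le> (\<Sum>g\<in>tuples s N. cmod (coef a s g * fourier_coeff d \<sigma> (\<lambda>i. - freq s g i)))"
    unfolding eq by (rule norm_sum)
  also have "\<dots> \<le> (\<Sum>g\<in>tuples s N. cmod (coef a s g) *
        (K * (1 + L2_set (\<lambda>i. real_of_int (freq s g i)) {1..d}) powr (- (real d - 1) / 2)))"
  proof (rule sum_mono)
    fix g
    \<comment> \<open>Integrating a character produces the Fourier coefficient at the negated
      frequency; the decay weight is even, so the sign is immaterial.\<close>
    have "L2_set (\<lambda>i. real_of_int (- freq s g i)) {1..d} = L2_set (\<lambda>i. real_of_int (freq s g i)) {1..d}"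
      by (simp add: L2_set_def)
    then have "cmod (fourier_coeff d \<sigma> (\<lambda>i. - freq s g i))
       \<le> K * (1 + L2_set (\<lambda>i. real_of_int (freq s g i)) {1..d}) powr (- (real d - 1) / 2)"
      using assms(3) unfolding fourier_decay_def by metis
    then show "cmod (coef a s g * fourier_coeff d \<sigma> (\<lambda>i. - freq s g i)) \<le> cmod (coef a s g) *
        (K * (1 + L2_set (\<lambda>i. real_of_int (freq s g i)) {1..d}) powr (- (real d - 1) / 2))"
      unfolding norm_mult by (rule mult_left_mono) simp
  qed
  finally show ?thesis .
qed

section \<open>Dyadic decomposition of the decay weight\<close>

text \<open>The least admissible j works. If j > 0, minimality gives a coordinate with 2^(j-1) < 8 *
  |x_i|, whence the constant 16; if j = 0, the summand 1 suffices.\<close>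

lemma dyadic_scale:
  fixes x :: "nat \<Rightarrow> real"
  assumes "\<And>i. i \<in> {1..d} \<Longrightarrow> 8 * \<bar>x i\<bar> \<le> 2 ^ J"
  obtains j where "j \<le> J" "\<forall>i\<in>{1..d}. 8 * \<bar>x i\<bar> \<le> 2 ^ j"
    "2 ^ j \<le> 16 * (1 + L2_set x {1..d})"
proof -
  let ?P = "\<lambda>j. \<forall>i\<in>{1..d}. 8 * \<bar>x i\<bar> \<le> 2 ^ j"
  define j where "j = (LEAST j. ?P j)"
  have P: "?P J" using assms by blast
  have j: "?P j" unfolding j_def by (rule LeastI) (rule P)
  have "j \<le> J" unfolding j_def by (rule Least_le) (rule P)
  moreover have "2 ^ j \<le> 16 * (1 + L2_set x {1..d})"
  proof (cases j)
    case 0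
    then show ?thesis using L2_set_nonneg[of x "{1..d}"] by simp
  next
    case (Suc k)
    then have "\<not> ?P k" using not_less_Least[of k ?P] by (simp add: j_def)
    then obtain i where i: "i \<in> {1..d}" "2 ^ k < 8 * \<bar>x i\<bar>" by (auto simp: not_le)
    have "\<bar>x i\<bar> \<le> L2_set (\<lambda>i. \<bar>x i\<bar>) {1..d}"
      using i(1) by (intro member_le_L2_set) auto
    also have "\<dots> = L2_set x {1..d}" by (simp add: L2_set_def)
    finally show ?thesis using i(2) Suc by simp
  qed
  ultimately show ?thesis using j that by blast
qed

text \<open>The single term at the scale of x already dominates the weight. Summing over all scales
  removes the dependence of j on x, so that the sum over frequencies can later be taken first at
  each fixed scale.\<close>

lemma decay_weight_le_dyadic_sum:
  fixes x :: "nat \<Rightarrow> real"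
  assumes "\<And>i. i \<in> {1..d} \<Longrightarrow> 8 * \<bar>x i\<bar> \<le> 2 ^ J" "0 \<le> \<kappa>"
  shows "(1 + L2_set x {1..d}) powr (- \<kappa>)
    \<le> 16 powr \<kappa> * (\<Sum>j\<le>J. 2 powr (- (real j * \<kappa>)) * of_bool (\<forall>i\<in>{1..d}. 8 * \<bar>x i\<bar> \<le> 2 ^ j))"
proof -
  obtain j where j: "j \<le> J" "\<forall>i\<in>{1..d}. 8 * \<bar>x i\<bar> \<le> 2 ^ j"
    "2 ^ j \<le> 16 * (1 + L2_set x {1..d})"
    using dyadic_scale[of d x J, OF assms(1)] by metis
  have "(1 + L2_set x {1..d}) powr (- \<kappa>) \<le> (2 powr real j / 16) powr (- \<kappa>)"
    using j(3) assms(2) by (intro powr_mono2') (simp_all add: powr_realpow)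
  also have "\<dots> = 16 powr \<kappa> * 2 powr (- (real j * \<kappa>))"
    by (simp add: powr_divide powr_powr powr_minus_divide)
  also have "2 powr (- (real j * \<kappa>))
      = 2 powr (- (real j * \<kappa>)) * of_bool (\<forall>i\<in>{1..d}. 8 * \<bar>x i\<bar> \<le> 2 ^ j)"
    using j(2) by simp
  also have "\<dots> \<le> (\<Sum>j\<le>J. 2 powr (- (real j * \<kappa>)) * of_bool (\<forall>i\<in>{1..d}. 8 * \<bar>x i\<bar> \<le> 2 ^ j))"
    using j(1) by (intro member_le_sum) auto
  finally show ?thesis by simp
qed

text \<open>J can be taken of size O(log N), and ln N is at most N^\<delta> / \<delta>.\<close>

lemma number_of_scales:
  fixes \<delta> :: real
  assumes "\<delta> > 0"
  obtains C where "C > 0"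
    "\<And>N. N \<ge> 1 \<Longrightarrow> \<exists>J. 8 * (real s * real N ^ d) \<le> 2 ^ J \<and> real J + 1 \<le> C * real N powr \<delta>"
proof
  \<comment> \<open>The 2 pays for rounding up to an integer and for counting the scales from 0 to
    J. Using s + 1 in place of s keeps the logarithm defined when s = 0.\<close>
  define A where "A = log 2 (8 * (real s + 1)) + 2"
  define C where "C = A + real d / (ln 2 * \<delta>)"
  have A: "A \<ge> 2" by (simp add: A_def)
  show "C > 0" unfolding C_def using A assms by (intro add_pos_nonneg) auto
  fix N :: nat assume N: "N \<ge> 1"
  define L where "L = log 2 (8 * ((real s + 1) * real N ^ d))"
  have L: "L = log 2 (8 * (real s + 1)) + real d * log 2 (real N)"
    using N by (simp add: L_def log_mult log_nat_power flip: mult.assoc)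
  have L0: "L \<ge> 0" unfolding L using N by (intro add_nonneg_nonneg) auto
  have "8 * (real s * real N ^ d) \<le> 8 * ((real s + 1) * real N ^ d)"
    by (simp add: mult_right_mono)
  also have "\<dots> = 2 powr L" unfolding L_def using N by (subst powr_log_cancel) auto
  also have "\<dots> \<le> 2 powr real (nat \<lceil>L\<rceil>)"
    using L0 by (intro powr_mono) linarith+
  finally have 1: "8 * (real s * real N ^ d) \<le> 2 ^ nat \<lceil>L\<rceil>" by (simp add: powr_realpow)
  have N1: "1 \<le> real N powr \<delta>" using N assms by (simp add: ge_one_powr_ge_zero)
  have "real (nat \<lceil>L\<rceil>) + 1 \<le> L + 2" using L0 by linarith
  also have "\<dots> = A + real d * ln (real N) / ln 2"
    by (simp add: L A_def log_def)
  also have "\<dots> \<le> A * real N powr \<delta> + real d * (real N powr \<delta> / \<delta>) / ln 2"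
    using A N N1 assms
    by (intro add_mono divide_right_mono mult_left_mono ln_powr_bound) auto
  also have "\<dots> = C * real N powr \<delta>" by (simp add: C_def field_simps)
  finally show "\<exists>J. 8 * (real s * real N ^ d) \<le> 2 ^ J \<and> real J + 1 \<le> C * real N powr \<delta>"
    using 1 by blast
qed

text \<open>With x = j and y = d: the normalisation 2^(j(d+1)/2) times the volume 2^(-jd) of the
  small cube is exactly the decay 2^(-j(d-1)/2) expected at frequencies of size 2^j. Both directions
  rest on this balance.\<close>

lemma scale_exponent: "x * (y + 1) / 2 + - (x * y) = - (x * ((y - 1) / 2))" for x y :: real
  by (simp add: algebra_simps add_divide_distrib diff_divide_distrib)

section \<open>From cubes to measures for even exponents\<close>

text \<open>Each dyadic scale contributes at most a constant times the bound for cubes, so summing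
  over scales loses only their number.\<close>

lemma cube_imp_measure:
  assumes "d \<ge> 2" "s > 0" "C_stmt d (real (2 * s))"
  shows "B_stmt d (real (2 * s))"
  unfolding B_stmt_def
proof (intro allI impI)
  fix \<epsilon> K :: real assume eps: "\<epsilon> > 0" and K: "K > 0"
  define p where "p = real (2 * s)"
  define \<kappa> where "\<kappa> = (real d - 1) / 2"
  have \<kappa>: "\<kappa> \<ge> 0" using assms(1) by (simp add: \<kappa>_def)
  \<comment> \<open>Positivity of s matters at z = 0, since \<open>0 powr 0\<close> is 0 while
    \<open>0 ^ 0\<close> is 1.\<close>
  have pw: "cmod z powr p = cmod z ^ (2 * s)" for z
    unfolding p_def by (rule powr_realpow') (use assms(2) in simp_all)
  \<comment> \<open>Half of \<epsilon> is spent on the estimate over cubes, the other half on the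
    number of scales.\<close>
  obtain C where C: "C > 0" and CP: "\<And>j N a. N \<ge> 1 \<Longrightarrow>
      2 powr (real j * (real d + 1) / 2) *
          (\<integral>x \<in> cube d (1 / 2 ^ j). cmod (weyl_sum d a x N) powr p \<partial>Leb d)
          \<le> C * real N powr (lam d p + \<epsilon> / 2) * l2_norm N a powr p"
    using assms(3) eps unfolding C_stmt_def p_def[symmetric] by (metis half_gt_zero)
  obtain D where D: "D > 0" and scales:
    "\<And>N. N \<ge> 1 \<Longrightarrow> \<exists>J. 8 * (real s * real N ^ d) \<le> 2 ^ J \<and> real J + 1 \<le> D * real N powr (\<epsilon> / 2)"
    using number_of_scales[of "\<epsilon> / 2" s d] eps by auto
  \<comment> \<open>The factors come, in order, from the Fourier decay, the dyadic weight, the low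
    frequency mass, the estimate over cubes and the number of scales.\<close>
  define C' where "C' = K * 16 powr \<kappa> * 4 ^ d * C * D"
  show "\<exists>C>0. \<forall>\<sigma>. sets \<sigma> = sets (torus d) \<longrightarrow> finite_measure \<sigma> \<longrightarrow> fourier_decay d K \<sigma> \<longrightarrow>
        (\<forall>N\<ge>1. \<forall>a. (\<integral>x. cmod (weyl_sum d a x N) powr real (2 * s) \<partial>\<sigma>)
             \<le> C * real N powr (lam d (real (2 * s)) + \<epsilon>) * l2_norm N a powr real (2 * s))"
    unfolding p_def[symmetric]
  proof (intro exI[of _ C'] conjI allI impI)
    show "C' > 0" using C D K by (simp add: C'_def)
    fix \<sigma> :: "(nat \<Rightarrow> real) measure" and N :: nat and a :: "nat \<Rightarrow> complex"
    assume \<sigma>: "sets \<sigma> = sets (torus d)" "finite_measure \<sigma>" "fourier_decay d K \<sigma>" and N: "N \<ge> 1"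
    from scales[OF N] obtain J where J: "8 * (real s * real N ^ d) \<le> 2 ^ J"
      and J_le: "real J + 1 \<le> D * real N powr (\<epsilon> / 2)" by blast
    define R where "R = C * real N powr (lam d p + \<epsilon> / 2) * l2_norm N a powr p"
    have R: "R \<ge> 0" using C by (simp add: R_def)
    define low where "low j g \<longleftrightarrow> (\<forall>i\<in>{1..d}. 8 * \<bar>real_of_int (freq s g i)\<bar> \<le> 2 ^ j)" for j g
    \<comment> \<open>This is the low frequency mass bound for the cube of side 2^(-j); the decay
      factor at scale j equals the normalisation \<open>u\<close> times the volume of that
      cube.\<close>
    have mass: "2 powr (- (real j * \<kappa>)) * (\<Sum>g\<in>tuples s N. cmod (coef a s g) * of_bool (low j g))
        \<le> 4 ^ d * R" for j
    proof -
      define u where "u = (2::real) powr (real j * (real d + 1) / 2)"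
      have u: "u > 0" by (simp add: u_def)
      have "(\<Sum>g | g \<in> tuples s N \<and> (\<forall>i\<in>{1..d}. 8 * \<bar>real_of_int (freq s g i)\<bar> * (1 / 2 ^ j) \<le> 1).
           cmod (coef a s g)) * (1 / 2 ^ j) ^ d \<le> 4 ^ d * (R / u)"
      proof (rule low_frequency_mass)
        fix b :: "nat \<Rightarrow> complex" assume "\<And>n. cmod (b n) = cmod (a n)"
        then have "l2_norm N b = l2_norm N a" by (intro l2_norm_cong) auto
        with CP[OF N, of j b] u show
          "(\<integral>x\<in>cube d (1 / 2 ^ j). cmod (weyl_sum d b x N) ^ (2 * s) \<partial>Leb d) \<le> R / u"
          by (simp add: R_def u_def pw pos_le_divide_eq mult.commute)
      qed simp
      also have "{g. g \<in> tuples s N \<and> (\<forall>i\<in>{1..d}. 8 * \<bar>real_of_int (freq s g i)\<bar> * (1 / 2 ^ j) \<le> 1)}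
          = {g \<in> tuples s N. low j g}"
        by (simp add: low_def field_simps)
      also have "(\<Sum>g | g \<in> tuples s N \<and> low j g. cmod (coef a s g))
          = (\<Sum>g\<in>tuples s N. cmod (coef a s g) * of_bool (low j g))"
        by (rule sum.mono_neutral_cong_left) auto
      finally have "(\<Sum>g\<in>tuples s N. cmod (coef a s g) * of_bool (low j g)) * (u * (1 / 2 ^ j) ^ d)
          \<le> 4 ^ d * R"
        using u by (simp add: field_simps)
      also have "u * (1 / 2 ^ j) ^ d = 2 powr (- (real j * \<kappa>))"
      proof -
        have "((1::real) / 2 ^ j) ^ d = 2 powr (- (real j * real d))"
          by (simp add: powr_minus_divide power_one_over powr_realpow flip: power_mult powr_powr of_nat_mult)
        then show ?thesis
          by (simp only: u_def \<kappa>_def scale_exponent flip: powr_add)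
      qed
      finally show ?thesis by (simp add: mult.commute)
    qed
    have weight: "(1 + L2_set (\<lambda>i. real_of_int (freq s g i)) {1..d}) powr (- \<kappa>)
       \<le> 16 powr \<kappa> * (\<Sum>j\<le>J. 2 powr (- (real j * \<kappa>)) * of_bool (low j g))" if "g \<in> tuples s N" for g
      unfolding low_def
    proof (rule decay_weight_le_dyadic_sum[OF _ \<kappa>])
      fix i assume "i \<in> {1..d}"
      then show "8 * \<bar>real_of_int (freq s g i)\<bar> \<le> 2 ^ J"
        using freq_bound[OF that N, of i d] J by simp
    qed
    have exponent: "- (real d - 1) / 2 = - \<kappa>"
      unfolding \<kappa>_def by (rule minus_divide_left[symmetric])
    have "(\<integral>x. cmod (weyl_sum d a x N) powr p \<partial>\<sigma>)
        \<le> (\<Sum>g\<in>tuples s N. cmod (coef a s g) *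
            (K * (1 + L2_set (\<lambda>i. real_of_int (freq s g i)) {1..d}) powr (- \<kappa>)))"
      unfolding pw exponent[symmetric] by (rule moment_le_coef_sum[OF \<sigma>])
    also have "\<dots> \<le> (\<Sum>g\<in>tuples s N. cmod (coef a s g) *
            (K * (16 powr \<kappa> * (\<Sum>j\<le>J. 2 powr (- (real j * \<kappa>)) * of_bool (low j g)))))"
      using K by (intro sum_mono mult_left_mono weight) auto
    also have "\<dots> = K * 16 powr \<kappa> * (\<Sum>g\<in>tuples s N. \<Sum>j\<le>J. 2 powr (- (real j * \<kappa>)) *
         (cmod (coef a s g) * of_bool (low j g)))"
      by (simp add: sum_distrib_left mult_ac)
    also have "\<dots> = K * 16 powr \<kappa> * (\<Sum>j\<le>J. 2 powr (- (real j * \<kappa>)) *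
         (\<Sum>g\<in>tuples s N. cmod (coef a s g) * of_bool (low j g)))"
      by (subst sum.swap) (simp only: sum_distrib_left)
    also have "\<dots> \<le> K * 16 powr \<kappa> * (\<Sum>j\<le>J. 4 ^ d * R)"
      using K by (intro mult_left_mono sum_mono mass) auto
    also have "\<dots> = K * 16 powr \<kappa> * 4 ^ d * R * (real J + 1)" by simp
    also have "\<dots> \<le> K * 16 powr \<kappa> * 4 ^ d * R * (D * real N powr (\<epsilon> / 2))"
      using K R J_le by (intro mult_left_mono) auto
    also have "\<dots> = C' * (real N powr (lam d p + \<epsilon> / 2) * real N powr (\<epsilon> / 2)) * l2_norm N a powr p"
      by (simp add: C'_def R_def mult_ac)
    also have "real N powr (lam d p + \<epsilon> / 2) * real N powr (\<epsilon> / 2) = real N powr (lam d p + \<epsilon>)"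
      by (simp add: add.assoc flip: powr_add)
    finally show "(\<integral>x. cmod (weyl_sum d a x N) powr p \<partial>\<sigma>)
        \<le> C' * real N powr (lam d p + \<epsilon>) * l2_norm N a powr p" .
  qed
qed

section \<open>Measures concentrated on small cubes\<close>

text \<open>For n > 0 this is the Fejer kernel divided by n, so that its peak value is 1. It is
  nonnegative, large near 0 and has spectrum in |m| < n.\<close>

definition fejer :: "nat \<Rightarrow> real \<Rightarrow> real" where
  "fejer n t = (cmod (\<Sum>k<n. e (real k * t)) / real n)\<^sup>2"

lemma fejer_nonneg [simp]: "0 \<le> fejer n t"
  by (simp add: fejer_def)

lemma fejer_le_1: "fejer n t \<le> 1"
proof -
  have "cmod (\<Sum>k<n. e (real k * t)) \<le> real n"
    by (rule order_trans[OF norm_sum]) simp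
  then show ?thesis by (cases "n = 0") (simp_all add: fejer_def power_le_one)
qed

lemma continuous_on_fejer: "continuous_on A (fejer n)"
  unfolding fejer_def[abs_def]
  by (cases "n = 0") (auto intro!: continuous_intros)

lemma fejer_measurable [measurable]: "fejer n \<in> borel_measurable borel"
  by (intro borel_measurable_continuous_onI continuous_on_fejer)

text \<open>Every exponential has real part at least 1/2, so the normalised sum has modulus at least
  1/2; squaring gives 1/4.\<close>

lemma fejer_ge:
  assumes "n > 0" "0 \<le> t" "\<And>k. k < n \<Longrightarrow> 8 * (real k * t) \<le> 1"
  shows "1 / 4 \<le> fejer n t"
proof -
  have "real n * (1 / 2) = (\<Sum>k<n. 1 / 2)" by simp
  also have "\<dots> \<le> (\<Sum>k<n. Re (e (real k * t)))"
    using assms by (intro sum_mono Re_e_ge) (simp add: abs_mult)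
  also have "\<dots> = Re (\<Sum>k<n. e (real k * t))" by simp
  also have "\<dots> \<le> cmod (\<Sum>k<n. e (real k * t))" by (rule complex_Re_le_cmod)
  finally have "1 / 2 \<le> cmod (\<Sum>k<n. e (real k * t)) / real n"
    using assms(1) by (simp add: field_simps)
  from power_mono[OF this, of 2] show ?thesis by (simp add: fejer_def power_divide)
qed

lemma fejer_expansion:
  "complex_of_real (fejer n t) = (\<Sum>k<n. \<Sum>l<n. e (of_int (int k - int l) * t)) / (of_nat n)\<^sup>2"
proof -
  let ?D = "\<Sum>k<n. e (real k * t)"
  have "complex_of_real (fejer n t) = ?D * cnj ?D / (of_nat n)\<^sup>2"
    by (simp only: complex_norm_square[symmetric]) (simp add: fejer_def power_divide)
  also have "?D * cnj ?D = (\<Sum>k<n. \<Sum>l<n. e (real k * t) * cnj (e (real l * t)))"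
    by (simp only: cnj_sum sum_product)
  also have "\<dots> = (\<Sum>k<n. \<Sum>l<n. e (of_int (int k - int l) * t))"
    by (simp flip: e_diff add: left_diff_distrib)
  finally show ?thesis .
qed

text \<open>By orthogonality the coefficient is n^(-2) times the number of pairs k, l < n with l - k
  = m. There are at most n such pairs, and none once |m| reaches n.\<close>

lemma norm_fejer_coeff_le:
  "cmod (\<integral>t\<in>{0..1}. of_real (fejer n t) * e (of_int m * t) \<partial>lborel)
    \<le> (if \<bar>m\<bar> < int n then 1 / real n else 0)"
proof -
  define S where "S = (\<Sum>k<n. \<Sum>l<n. if int k - int l + m = 0 then 1 else 0 :: real)"
  have "(\<integral>t\<in>{0..1}. of_real (fejer n t) * e (of_int m * t) \<partial>lborel)
      = (\<integral>t\<in>{0..1}. (\<Sum>k<n. \<Sum>l<n. e (of_int (int k - int l + m) * t)) / (of_nat n)\<^sup>2 \<partial>lborel)"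
    by (simp add: fejer_expansion sum_distrib_right distrib_right flip: e_add)
  also have "\<dots> = (\<Sum>k<n. \<Sum>l<n. \<integral>t\<in>{0..1}. e (of_int (int k - int l + m) * t) \<partial>lborel) / (of_nat n)\<^sup>2"
    by (simp only: set_integral_divide_zero set_integral_sum set_integrable_e set_integrable_sum)
  also have "\<dots> = of_real (S / (real n)\<^sup>2)"
    unfolding integral_e_unit S_def by (simp add: if_distrib cong: if_cong)
  finally have eq: "(\<integral>t\<in>{0..1}. of_real (fejer n t) * e (of_int m * t) \<partial>lborel) = of_real (S / (real n)\<^sup>2)" .
  have S0: "S \<ge> 0" unfolding S_def by (intro sum_nonneg) simp
  show ?thesis
  proof (cases "\<bar>m\<bar> < int n")
    case True
    have "S \<le> (\<Sum>k<n. 1)"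
      unfolding S_def
    proof (rule sum_mono)
      fix k
      \<comment> \<open>For fixed k only l = k + m can contribute. If k + m is negative the left
        side is 0, so the truncation by \<open>nat\<close> is harmless in an upper bound.\<close>
      have "(\<Sum>l<n. if int k - int l + m = 0 then 1 else 0 :: real)
          \<le> (\<Sum>l<n. if l = nat (int k + m) then 1 else 0)"
        by (rule sum_mono) auto
      also have "\<dots> \<le> 1" by simp
      finally show "(\<Sum>l<n. if int k - int l + m = 0 then 1 else 0 :: real) \<le> 1" .
    qed
    then have "S / (real n)\<^sup>2 \<le> real n / (real n)\<^sup>2" by (intro divide_right_mono) auto
    also have "\<dots> = 1 / real n" using True by (simp add: power2_eq_square)
    finally show ?thesis using True S0 unfolding eq norm_of_real by simp
  next
    case False
    then have "S = 0" unfolding S_def by (intro sum.neutral ballI) auto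
    with False show ?thesis unfolding eq by simp
  qed
qed

section \<open>The test measures on the torus\<close>

text \<open>The density lives on the closed cube, where the integral lemmas above apply;
  \<open>frac\<close> then carries it to the half-open fundamental domain, sending faces at 1 to
  faces at 0. The weight \<open>W\<close> will be the normalisation of the cube estimate.\<close>

definition cube_measure :: "nat \<Rightarrow> real \<Rightarrow> nat \<Rightarrow> (nat \<Rightarrow> real) measure" where
  "cube_measure d W n =
    distr (density (Leb d) (\<lambda>x. ennreal (indicator (cube d 1) x * (W * (\<Prod>i=1..d. fejer n (x i))))))
      (torus d) (\<lambda>x. \<lambda>i\<in>{1..d}. frac (x i))"

lemma sets_cube_measure: "sets (cube_measure d W n) = sets (torus d)"
  by (simp add: cube_measure_def)

lemma fejer_prod_measurable [measurable]:
  "(\<lambda>x. \<Prod>i=1..d. fejer n (x i)) \<in> borel_measurable (Leb d)"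
  by (rule borel_measurable_prod) measurable

lemma fejer_prod_nonneg [simp]: "0 \<le> (\<Prod>i\<in>A. fejer n (x i))"
  by (rule prod_nonneg) simp

lemma fejer_prod_le_1: "(\<Prod>i\<in>A. fejer n (x i)) \<le> 1"
  by (rule prod_le_1) (simp add: fejer_le_1)

lemma frac_measurable_torus:
  "(\<lambda>x. \<lambda>i\<in>{1..d}. frac (x i)) \<in> measurable (Leb d) (torus d)"
proof -
  have "(\<lambda>x. frac (x i)) \<in> measurable (Leb d) (restrict_space borel {0..<1})"
    if i: "i \<in> {1..d}" for i
  proof (rule measurable_restrict_space2)
    have frac: "(frac :: real \<Rightarrow> real) \<in> borel_measurable borel"
      unfolding frac_def by measurable
    have "(\<lambda>x. x i) \<in> borel_measurable (Leb d)" using i by measurable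
    then show "(\<lambda>x. frac (x i)) \<in> borel_measurable (Leb d)"
      by (rule measurable_compose[OF _ frac])
  qed (simp add: frac_lt_1)
  then show ?thesis unfolding torus_def by (rule measurable_restrict)
qed

lemma finite_cube_measure:
  assumes "0 \<le> W"
  shows "finite_measure (cube_measure d W n)"
proof -
  let ?w = "\<lambda>x. indicator (cube d 1) x * (W * (\<Prod>i=1..d. fejer n (x i)))"
  have "(\<integral>\<^sup>+x. ennreal (?w x) \<partial>Leb d) \<le> (\<integral>\<^sup>+x. ennreal W * indicator (cube d 1) x \<partial>Leb d)"
  proof (rule nn_integral_mono)
    fix x
    show "ennreal (?w x) \<le> ennreal W * indicator (cube d 1) x"
      using assms fejer_prod_le_1[of n x "{1..d}"]
      by (auto split: split_indicator intro!: ennreal_leI mult_left_le)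
  qed
  also have "\<dots> = ennreal W * emeasure (Leb d) (cube d 1)"
    by (rule nn_integral_cmult_indicator) (rule cube_sets)
  also have "\<dots> < \<infinity>" using emeasure_cube[of 1 d] by (simp add: ennreal_mult_less_top)
  finally have fin: "(\<integral>\<^sup>+x. ennreal (?w x) \<partial>Leb d) < \<infinity>" .
  have w[measurable]: "?w \<in> borel_measurable (Leb d)" by measurable
  have "emeasure (density (Leb d) (\<lambda>x. ennreal (?w x))) (space (Leb d)) = (\<integral>\<^sup>+x. ennreal (?w x) \<partial>Leb d)"
    by (subst emeasure_density) (auto intro!: nn_integral_cong)
  with fin have "finite_measure (density (Leb d) (\<lambda>x. ennreal (?w x)))"
    by (intro finite_measureI) simp
  then show ?thesis
    unfolding cube_measure_def
    by (rule finite_measure.finite_measure_distr) (simp add: frac_measurable_torus[simplified])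
qed

lemma integral_cube_measure:
  fixes f :: "_ \<Rightarrow> 'b::{banach, second_countable_topology}"
  assumes f: "f \<in> borel_measurable (torus d)" and W: "0 \<le> W"
  shows "(\<integral>x. f x \<partial>cube_measure d W n)
    = (\<integral>x\<in>cube d 1. (W * (\<Prod>i=1..d. fejer n (x i))) *\<^sub>R f (\<lambda>i\<in>{1..d}. frac (x i)) \<partial>Leb d)"
proof -
  let ?w = "\<lambda>x. indicator (cube d 1) x * (W * (\<Prod>i=1..d. fejer n (x i)))"
  have w: "?w \<in> borel_measurable (Leb d)" by measurable
  have "(\<integral>x. f x \<partial>cube_measure d W n)
      = (\<integral>x. f (\<lambda>i\<in>{1..d}. frac (x i)) \<partial>density (Leb d) (\<lambda>x. ennreal (?w x)))"
    unfolding cube_measure_def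
    by (rule integral_distr[OF _ f]) (simp add: frac_measurable_torus[simplified])
  also have "\<dots> = (\<integral>x. ?w x *\<^sub>R f (\<lambda>i\<in>{1..d}. frac (x i)) \<partial>Leb d)"
    by (rule integral_density[OF measurable_compose[OF frac_measurable_torus f] w]) (use W in simp)
  finally show ?thesis by (simp add: set_lebesgue_integral_def)
qed

lemma character_frac_restrict:
  "character d m (\<lambda>i\<in>{1..d}. frac (x i)) = character d m x"
  by (subst character_frac[symmetric]) (rule character_cong, simp)

text \<open>Periodicity removes \<open>frac\<close>, and the product density makes the coefficient
  factor into Fejer coefficients in one variable.\<close>

lemma fourier_coeff_cube_measure:
  assumes "0 \<le> W"
  shows "cmod (fourier_coeff d (cube_measure d W n) \<xi>)
    \<le> W * (\<Prod>i=1..d. if \<bar>\<xi> i\<bar> < int n then 1 / real n else 0)"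
proof -
  let ?I = "\<lambda>i. \<integral>t\<in>{0..1}. of_real (fejer n t) * e (of_int (- \<xi> i) * t) \<partial>lborel"
  have "fourier_coeff d (cube_measure d W n) \<xi>
      = (\<integral>x\<in>cube d 1. (W * (\<Prod>i=1..d. fejer n (x i))) *\<^sub>R character d (\<lambda>i. - \<xi> i) x \<partial>Leb d)"
    unfolding fourier_coeff_character
    by (subst integral_cube_measure[OF character_measurable assms])
      (simp_all only: character_frac_restrict sets_torus_coordinate[OF refl])
  also have "\<dots> = (\<integral>x\<in>cube d 1. of_real W *
      (\<Prod>i=1..d. of_real (fejer n (x i)) * e (of_int (- \<xi> i) * x i)) \<partial>Leb d)"
    by (simp add: character_prod prod.distrib scaleR_conv_of_real mult.assoc)
  also have "\<dots> = of_real W * (\<Prod>i=1..d. ?I i)"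
    by (subst set_integral_mult_right, subst integral_cube_prod)
      (auto intro!: borel_integrable_atLeastAtMost' continuous_intros continuous_on_fejer)
  finally have "cmod (fourier_coeff d (cube_measure d W n) \<xi>) = W * (\<Prod>i=1..d. cmod (?I i))"
    using assms by (simp add: norm_mult prod_norm)
  also have "\<dots> \<le> W * (\<Prod>i=1..d. if \<bar>\<xi> i\<bar> < int n then 1 / real n else 0)"
    using norm_fejer_coeff_le[of n "- \<xi> _"] assms
    by (intro mult_left_mono prod_mono conjI) simp_all
  finally show ?thesis .
qed

text \<open>The constant is independent of j, which is the point of the construction: coefficients
  are at most W * n^(-d), of order 2^(-j(d-1)/2), and they vanish unless all |\<xi>_i| < n, where 1
  + |\<xi>| is at most (d + 1) * 2^j.\<close>

lemma fourier_decay_cube_measure: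
  assumes "d \<ge> 1"
  shows "fourier_decay d (8 ^ d * (real d + 1) powr ((real d - 1) / 2))
    (cube_measure d (2 powr (real j * (real d + 1) / 2)) (2 ^ (j - 3)))"
  unfolding fourier_decay_def
proof
  fix \<xi> :: "nat \<Rightarrow> int"
  define \<kappa> where "\<kappa> = (real d - 1) / 2"
  define W where "W = (2::real) powr (real j * (real d + 1) / 2)"
  \<comment> \<open>Subtraction is truncated, so n = 1 for j < 3; the comparisons n \<le> 2^j and
    2^j \<le> 8n hold in that case too.\<close>
  define n where "n = (2::nat) ^ (j - 3)"
  define L where "L = L2_set (\<lambda>i. real_of_int (\<xi> i)) {1..d}"
  have \<kappa>: "\<kappa> \<ge> 0" using assms by (simp add: \<kappa>_def)
  have exponent: "- (real d - 1) / 2 = - \<kappa>"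
    unfolding \<kappa>_def by (rule minus_divide_left[symmetric])
  have W: "W \<ge> 0" by (simp add: W_def)
  have n: "n > 0" "n \<le> 2 ^ j" by (simp_all add: n_def)
  have "(2::nat) ^ j \<le> 2 ^ (3 + (j - 3))" by (rule power_increasing) auto
  then have "2 ^ j \<le> 8 * n" by (simp add: n_def power_add)
  then have n8: "2 ^ j \<le> 8 * real n" by (metis of_nat_le_iff of_nat_mult of_nat_numeral of_nat_power)
  have "cmod (fourier_coeff d (cube_measure d W n) \<xi>)
      \<le> W * (\<Prod>i=1..d. if \<bar>\<xi> i\<bar> < int n then 1 / real n else 0)"
    by (rule fourier_coeff_cube_measure[OF W])
  also have "\<dots> \<le> 8 ^ d * (real d + 1) powr \<kappa> * (1 + L) powr (- \<kappa>)"
  proof (cases "\<forall>i\<in>{1..d}. \<bar>\<xi> i\<bar> < int n")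
    case True
    have "1 / real n \<le> 8 / 2 ^ j" using n n8 by (simp add: field_simps)
    then have "(1 / real n) ^ d \<le> (8 / 2 ^ j) ^ d" by (intro power_mono) auto
    then have "W * (\<Prod>i=1..d. if \<bar>\<xi> i\<bar> < int n then 1 / real n else 0) \<le> W * (8 / 2 ^ j) ^ d"
      using True W by (intro mult_left_mono) auto
    also have "\<dots> = 8 ^ d * (W * 2 powr (- (real j * real d)))"
      by (simp add: powr_minus_divide power_divide powr_realpow flip: power_mult powr_powr of_nat_mult)
    also have "W * 2 powr (- (real j * real d)) = 2 powr (- (real j * \<kappa>))"
      by (simp only: W_def \<kappa>_def scale_exponent flip: powr_add)
    \<comment> \<open>The inserted factor d + 1 prepares the comparison of 1 + |\<xi>| with (d + 1)
      * 2^j, where |\<xi>| is bounded by the sum of the coordinates' moduli.\<close>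
    also have "\<dots> = (real d + 1) powr \<kappa> * ((real d + 1) * 2 ^ j) powr (- \<kappa>)"
      by (simp add: powr_mult powr_powr powr_minus_divide flip: powr_realpow)
    also have "\<dots> \<le> (real d + 1) powr \<kappa> * (1 + L) powr (- \<kappa>)"
    proof (intro mult_left_mono powr_mono2')
      have "L \<le> (\<Sum>i=1..d. \<bar>real_of_int (\<xi> i)\<bar>)" unfolding L_def by (rule L2_set_le_sum_abs)
      also have "\<dots> \<le> (\<Sum>i=1..d. 2 ^ j)"
      proof (rule sum_mono)
        fix i assume "i \<in> {1..d}"
        with True have "\<bar>\<xi> i\<bar> \<le> int n" by (auto simp: less_imp_le)
        also have "\<dots> \<le> 2 ^ j" using n(2) by (metis of_nat_le_iff of_nat_numeral of_nat_power)
        finally have "real_of_int \<bar>\<xi> i\<bar> \<le> real_of_int (2 ^ j)" by (simp only: of_int_le_iff)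
        then show "\<bar>real_of_int (\<xi> i)\<bar> \<le> 2 ^ j" by simp
      qed
      finally have "L \<le> real d * 2 ^ j" by simp
      moreover have "(1::real) \<le> 2 ^ j" by (rule one_le_power) simp
      ultimately show "1 + L \<le> (real d + 1) * 2 ^ j" by (simp only: distrib_right)
      show "0 < 1 + L" unfolding L_def using L2_set_nonneg by (intro add_pos_nonneg) auto
    qed (use \<kappa> in auto)
    finally show ?thesis by (simp add: mult.assoc)
  next
    case False
    then have "(\<Prod>i=1..d. if \<bar>\<xi> i\<bar> < int n then 1 / real n else 0) = 0"
      by (intro prod_zero) auto
    then show ?thesis by (simp only: mult_zero_right) simp
  qed
  finally show "cmod (fourier_coeff d (cube_measure d (2 powr (real j * (real d + 1) / 2)) (2 ^ (j - 3))) \<xi>)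
    \<le> 8 ^ d * (real d + 1) powr ((real d - 1) / 2)
        * (1 + L2_set (\<lambda>i. real_of_int (\<xi> i)) {1..d}) powr (- (real d - 1) / 2)"
    unfolding exponent by (simp add: W_def n_def L_def \<kappa>_def)
qed

section \<open>From measures to cubes\<close>

text \<open>On the small cube each of the d Fejer factors is at least 1/4; on the rest of the unit
  cube the density is nonnegative, so enlarging the domain only helps.\<close>

lemma cube_integral_le_cube_measure:
  assumes "0 \<le> W" "0 \<le> p"
  shows "W * (\<integral>x\<in>cube d (1 / 2 ^ j). cmod (weyl_sum d a x N) powr p \<partial>Leb d)
    \<le> 4 ^ d * (\<integral>x. cmod (weyl_sum d a x N) powr p \<partial>cube_measure d W (2 ^ (j - 3)))"
proof -
  define n where "n = (2::nat) ^ (j - 3)"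
  define F where "F x = cmod (weyl_sum d a x N) powr p" for x
  \<comment> \<open>The trivial bound on the Weyl sum, used only to make both integrands
    integrable.\<close>
  define M where "M = (\<Sum>n=1..N. cmod (a n)) powr p"
  let ?w = "\<lambda>x. \<Prod>i=1..d. fejer n (x i)"
  have F: "0 \<le> F x" "F x \<le> M" for x
    using norm_weyl_sum_le[of d a x N] assms(2) by (auto simp: F_def M_def intro!: powr_mono2)
  have meas [measurable]: "F \<in> borel_measurable (Leb d)" unfolding F_def[abs_def] by measurable
  have "character d m \<in> borel_measurable (torus d)" for m
    by (rule character_measurable) (rule sets_torus_coordinate[OF refl])
  then have meas': "F \<in> borel_measurable (torus d)"
    unfolding F_def[abs_def] weyl_sum_character by measurable
  have frac: "F (\<lambda>i\<in>{1..d}. frac (x i)) = F x" for x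
    unfolding F_def weyl_sum_character character_frac_restrict ..
  have "W * (\<integral>x\<in>cube d (1 / 2 ^ j). F x \<partial>Leb d)
      = (\<integral>x. indicator (cube d (1 / 2 ^ j)) x *\<^sub>R (W * F x) \<partial>Leb d)"
    unfolding set_lebesgue_integral_def integral_mult_right_zero[symmetric]
    by (rule Bochner_Integration.integral_cong) simp_all
  also have "\<dots> \<le> (\<integral>x. indicator (cube d 1) x *\<^sub>R (4 ^ d * (W * ?w x * F x)) \<partial>Leb d)"
  proof (rule integral_mono)
    show "integrable (Leb d) (\<lambda>x. indicator (cube d (1 / 2 ^ j)) x *\<^sub>R (W * F x))"
      unfolding set_integrable_def[symmetric]
    proof (rule set_integrable_cube_bounded[where B = "W * M"])
      show "(\<lambda>x. W * F x) \<in> borel_measurable (Leb d)" by measurable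
    qed (use F assms in \<open>auto simp: abs_mult intro!: mult_left_mono\<close>)
    show "integrable (Leb d) (\<lambda>x. indicator (cube d 1) x *\<^sub>R (4 ^ d * (W * ?w x * F x)))"
      unfolding set_integrable_def[symmetric]
    proof (rule set_integrable_cube_bounded[where B = "4 ^ d * (W * 1 * M)"])
      show "(\<lambda>x. 4 ^ d * (W * ?w x * F x)) \<in> borel_measurable (Leb d)" by measurable
      fix x
      have "norm (4 ^ d * (W * ?w x * F x)) = 4 ^ d * (W * ?w x * F x)"
        using F assms fejer_prod_nonneg[of n x "{1..d}"] by (simp add: abs_mult del: fejer_prod_nonneg)
      also have "\<dots> \<le> 4 ^ d * (W * 1 * M)"
        using F assms fejer_prod_le_1[of n x "{1..d}"]
        by (intro mult_left_mono mult_mono) auto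
      finally show "norm (4 ^ d * (W * ?w x * F x)) \<le> 4 ^ d * (W * 1 * M)" .
    qed simp
    fix x
    show "indicator (cube d (1 / 2 ^ j)) x *\<^sub>R (W * F x)
        \<le> indicator (cube d 1) x *\<^sub>R (4 ^ d * (W * ?w x * F x))"
    proof (cases "x \<in> cube d (1 / 2 ^ j)")
      case True
      then have x: "0 \<le> x i" "x i \<le> 1 / 2 ^ j" if "i \<in> {1..d}" for i
        using that by (auto simp: PiE_def Pi_def)
      have "(1::real) / 2 ^ j \<le> 1" by simp
      then have "x i \<in> {0..1}" if "i \<in> {1..d}" for i
        using x(1)[OF that] order_trans[OF x(2)[OF that]] by simp
      with True have cube1: "x \<in> cube d 1" by (simp add: PiE_def Pi_def)
      have "(1 / 4) ^ d = (\<Prod>i=1..d. 1 / 4 :: real)" by simp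
      also have "\<dots> \<le> ?w x"
      proof (intro prod_mono conjI fejer_ge)
        fix i k assume i: "i \<in> {1..d}" and k: "k < n"
        \<comment> \<open>If j < 3 then n = 1 and only k = 0 occurs; otherwise 8n = 2^j.\<close>
        have "8 * k \<le> 2 ^ j"
        proof (cases "j \<ge> 3")
          case True
          then have "(2::nat) ^ j = 2 ^ (3 + (j - 3))" by simp
          with k show ?thesis by (simp only: power_add n_def) simp
        qed (use k in \<open>simp add: n_def\<close>)
        then have "8 * real k \<le> 2 ^ j" by (metis of_nat_le_iff of_nat_mult of_nat_numeral of_nat_power)
        then have "8 * real k * x i \<le> 2 ^ j * (1 / 2 ^ j)"
          using x[OF i] by (intro mult_mono) auto
        then show "8 * (real k * x i) \<le> 1" by simp
      qed (use x in \<open>auto simp: n_def\<close>)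
      finally have "1 \<le> 4 ^ d * ?w x" by (simp add: power_divide field_simps)
      then have "1 * (W * F x) \<le> (4 ^ d * ?w x) * (W * F x)"
        using F assms by (intro mult_right_mono) auto
      then show ?thesis using True cube1 by (simp add: mult_ac)
    next
      case False
      then show ?thesis using F assms by (auto split: split_indicator)
    qed
  qed
  also have "\<dots> = 4 ^ d * (\<integral>x. F x \<partial>cube_measure d W n)"
    unfolding integral_cube_measure[OF meas' assms(1)] frac
      set_lebesgue_integral_def integral_mult_right_zero[symmetric]
    by (rule Bochner_Integration.integral_cong) simp_all
  finally show ?thesis by (simp add: F_def n_def)
qed

text \<open>All test measures share one decay constant \<open>K\<close>, and the constant provided
  by \<open>B_stmt\<close> depends on the measure only through \<open>K\<close>; hence the resulting
  bound is uniform in j.\<close>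

lemma measure_imp_cube:
  assumes "d \<ge> 1" "p > 0" "B_stmt d p"
  shows "C_stmt d p"
  unfolding C_stmt_def
proof (intro allI impI)
  fix \<epsilon> :: real assume "\<epsilon> > 0"
  moreover define K where "K = 8 ^ d * (real d + 1) powr ((real d - 1) / 2)"
  moreover have "K > 0" by (simp add: K_def)
  ultimately obtain C where "C > 0" and C: "\<And>\<sigma> N a. sets \<sigma> = sets (torus d) \<Longrightarrow> finite_measure \<sigma> \<Longrightarrow>
      fourier_decay d K \<sigma> \<Longrightarrow> N \<ge> 1 \<Longrightarrow> (\<integral>x. cmod (weyl_sum d a x N) powr p \<partial>\<sigma>)
        \<le> C * real N powr (lam d p + \<epsilon>) * l2_norm N a powr p"
    using assms(3) unfolding B_stmt_def by metis
  show "\<exists>C>0. \<forall>j. \<forall>N\<ge>1. \<forall>a. 2 powr (real j * (real d + 1) / 2) *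
          (\<integral>x\<in>cube d (1 / 2 ^ j). cmod (weyl_sum d a x N) powr p \<partial>Leb d)
          \<le> C * real N powr (lam d p + \<epsilon>) * l2_norm N a powr p"
  proof (intro exI[of _ "4 ^ d * C"] conjI allI impI)
    show "4 ^ d * C > 0" using \<open>C > 0\<close> by simp
    fix j N :: nat and a assume N: "N \<ge> 1"
    let ?W = "2 powr (real j * (real d + 1) / 2)"
    let ?\<sigma> = "cube_measure d ?W (2 ^ (j - 3))"
    have "?W * (\<integral>x\<in>cube d (1 / 2 ^ j). cmod (weyl_sum d a x N) powr p \<partial>Leb d)
        \<le> 4 ^ d * (\<integral>x. cmod (weyl_sum d a x N) powr p \<partial>?\<sigma>)"
      using assms(2) by (intro cube_integral_le_cube_measure) auto
    also have "\<dots> \<le> 4 ^ d * (C * real N powr (lam d p + \<epsilon>) * l2_norm N a powr p)"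
      using fourier_decay_cube_measure[OF assms(1), folded K_def] N
      by (intro mult_left_mono C finite_cube_measure sets_cube_measure) auto
    finally show "?W * (\<integral>x\<in>cube d (1 / 2 ^ j). cmod (weyl_sum d a x N) powr p \<partial>Leb d)
        \<le> 4 ^ d * C * real N powr (lam d p + \<epsilon>) * l2_norm N a powr p"
      by (simp add: mult.assoc)
  qed
qed

theorem proposition2p2:
  fixes d :: nat
  assumes "d \<ge> 2"
  shows "(\<forall>p::real. p > 0 \<longrightarrow> B_stmt d p \<longrightarrow> C_stmt d p) \<and>
         (\<forall>q::nat. q > 0 \<longrightarrow> even q \<longrightarrow> C_stmt d (real q) \<longrightarrow> B_stmt d (real q))"
  using assms measure_imp_cube cube_imp_measure by (auto elim!: evenE)

end
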